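(* Let $G=(G,* )$ be a left quasigroup satisfying, for all $a,b,c,d\in G$, $$(b*c)*(a\backslash_G((a*c)*((b*c)\backslash_G(b*d))))=b*(a\backslash_G((a*c)*d)),$$ $$(a*c)*((b*c)\backslash_G(b*d))=((a*c)*d)*((b*(a\backslash_G((a*c)*d)))\backslash_G(b*d)).$$ Let $M$ be the ternary system $(G,\mu^G_3)$ with $\mu^G_3(a,b,c)=b*(a\backslash_G c)$ $(a,b,c\in G)$. Let $L$ be a left quasigroup and $\pi:L\to G$ a bijection. Then the dynamical Yang-Baxter map $R^{(L,M,\pi)}(\lambda)$ satisfies the unitary condition if and only if $$(a*b)*b=a\quad(\forall a,b\in G).$$
   Context: A left quasigroup $(L,\cdot)$ is a nonempty set $L$ with a binary operation such that for all $u,w\in L$ there is a unique $v\in L$ with $u\cdot v=w$; this $v$ is denoted $u\backslash_L w$ (similarly $\backslash_G$ for $(G,* )$), and $uv$ means $u\cdot v$. A ternary system $(M,\mu)$ is a nonempty set $M$ with a map $\mu:M^3\to M$. Given a left quasigroup $L$, a ternary system $M=(M,\mu)$ and a bijection $\pi:L\to M$, for $\lambda,u,v\in L$: $$\xi^{(L,M,\pi)}_\lambda(u)(v)=\lambda\backslash_L\pi^{-1}\bigl(\mu(\pi(\lambda),\pi(\lambda u),\pi((\lambda u)v))\bigr),$$ $$\eta^{(L,M,\pi)}_\lambda(u)(v)=\bigl(\lambda\,\xi^{(L,M,\pi)}_\lambda(v)(u)\bigr)\backslash_L\bigl((\lambda v)u\bigr),$$ $$R^{(L,M,\pi)}(\lambda)(u,v)=\bigl(\eta^{(L,M,\pi)}_\lambda(v)(u),\xi^{(L,M,\pi)}_\lambda(u)(v)\bigr).$$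 A family $R(\lambda):L\times L\to L\times L$ ($\lambda\in L$) satisfies the unitary condition iff $R(\lambda)P_LR(\lambda)=P_L$ for all $\lambda\in L$, where $P_L(u,v)=(v,u)$. *)

theory Defs
  imports "HOL-Algebra.Congruence"
begin

record 'a magma = "'a partial_object" +
  binop :: "'a \<Rightarrow> 'a \<Rightarrow> 'a"  (infixl \<open>\<cdot>\<index>\<close> 70)

record 'a ternary = "'a partial_object" +
  ternop :: "'a \<Rightarrow> 'a \<Rightarrow> 'a \<Rightarrow> 'a"

definition left_quasigroup :: "'a magma \<Rightarrow> bool" where
  "left_quasigroup L \<longleftrightarrow>
     carrier L \<noteq> {} \<and>
     (\<forall>u\<in>carrier L. \<forall>v\<in>carrier L. u \<cdot>\<^bsub>L\<^esub> v \<in> carrier L) \<and>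
     (\<forall>u\<in>carrier L. \<forall>w\<in>carrier L. \<exists>!v. v \<in> carrier L \<and> u \<cdot>\<^bsub>L\<^esub> v = w)"

definition ldiv :: "'a magma \<Rightarrow> 'a \<Rightarrow> 'a \<Rightarrow> 'a"  (infixl \<open>\<setminus>\<index>\<close> 70) where
  "u \<setminus>\<^bsub>L\<^esub> w = (THE v. v \<in> carrier L \<and> u \<cdot>\<^bsub>L\<^esub> v = w)"

definition ternary_system :: "'a ternary \<Rightarrow> bool" where
  "ternary_system M \<longleftrightarrow>
     carrier M \<noteq> {} \<and>
     (\<forall>a\<in>carrier M. \<forall>b\<in>carrier M. \<forall>c\<in>carrier M. ternop M a b c \<in> carrier M)"

definition mu3_system :: "'a magma \<Rightarrow> 'a ternary" where
  "mu3_system G =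
     \<lparr>carrier = carrier G, ternop = (\<lambda>a b c. b \<cdot>\<^bsub>G\<^esub> (a \<setminus>\<^bsub>G\<^esub> c))\<rparr>"

definition xi :: "'l magma \<Rightarrow> 'm ternary \<Rightarrow> ('l \<Rightarrow> 'm) \<Rightarrow> 'l \<Rightarrow> 'l \<Rightarrow> 'l \<Rightarrow> 'l" where
  "xi L M p l u v =
     l \<setminus>\<^bsub>L\<^esub> inv_into (carrier L) p (ternop M (p l) (p (l \<cdot>\<^bsub>L\<^esub> u)) (p ((l \<cdot>\<^bsub>L\<^esub> u) \<cdot>\<^bsub>L\<^esub> v)))"

definition eta :: "'l magma \<Rightarrow> 'm ternary \<Rightarrow> ('l \<Rightarrow> 'm) \<Rightarrow> 'l \<Rightarrow> 'l \<Rightarrow> 'l \<Rightarrow> 'l" where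
  "eta L M p l u v =
     (l \<cdot>\<^bsub>L\<^esub> xi L M p l v u) \<setminus>\<^bsub>L\<^esub> ((l \<cdot>\<^bsub>L\<^esub> v) \<cdot>\<^bsub>L\<^esub> u)"

definition R_map :: "'l magma \<Rightarrow> 'm ternary \<Rightarrow> ('l \<Rightarrow> 'm) \<Rightarrow> 'l \<Rightarrow> 'l \<times> 'l \<Rightarrow> 'l \<times> 'l" where
  "R_map L M p l = (\<lambda>(u, v). (eta L M p l v u, xi L M p l u v))"

text \<open>Equality of maps on \<open>L \<times> L\<close> is equality on \<open>carrier L \<times> carrier L\<close>;
  the flip \<open>P\<^sub>L\<close> is \<open>prod.swap\<close>.\<close>

definition unitary_condition :: "'l magma \<Rightarrow> ('l \<Rightarrow> 'l \<times> 'l \<Rightarrow> 'l \<times> 'l) \<Rightarrow> bool" where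
  "unitary_condition L R \<longleftrightarrow>
     (\<forall>l\<in>carrier L. \<forall>x\<in>carrier L \<times> carrier L. (R l \<circ> prod.swap \<circ> R l) x = prod.swap x)"

lemma left_quasigroup_closed:
  assumes "left_quasigroup L" "u \<in> carrier L" "v \<in> carrier L"
  shows "u \<cdot>\<^bsub>L\<^esub> v \<in> carrier L"
  using assms by (simp add: left_quasigroup_def)

lemma ldiv_closed:
  assumes "left_quasigroup L" "u \<in> carrier L" "w \<in> carrier L"
  shows "u \<setminus>\<^bsub>L\<^esub> w \<in> carrier L" and "u \<cdot>\<^bsub>L\<^esub> (u \<setminus>\<^bsub>L\<^esub> w) = w"
proof -
  have "\<exists>!v. v \<in> carrier L \<and> u \<cdot>\<^bsub>L\<^esub> v = w"
    using assms by (simp add: left_quasigroup_def)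
  from theI'[OF this]
  show "u \<setminus>\<^bsub>L\<^esub> w \<in> carrier L" and "u \<cdot>\<^bsub>L\<^esub> (u \<setminus>\<^bsub>L\<^esub> w) = w"
    by (simp_all add: ldiv_def)
qed

lemma ternary_system_mu3_system:
  assumes "left_quasigroup G"
  shows "ternary_system (mu3_system G)"
proof -
  have "carrier G \<noteq> {}"
    using assms by (simp add: left_quasigroup_def)
  then show ?thesis
    using assms by (simp add: ternary_system_def mu3_system_def left_quasigroup_closed ldiv_closed)
qed

lemma R_map_closed:
  assumes L: "left_quasigroup L" and M: "ternary_system M"
    and p: "bij_betw p (carrier L) (carrier M)" and l: "l \<in> carrier L"
  shows "R_map L M p l \<in> carrier L \<times> carrier L \<rightarrow> carrier L \<times> carrier L"
proof -
  have inv: "inv_into (carrier L) p y \<in> carrier L" if "y \<in> carrier M" for y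
    using p that by (metis bij_betw_def inv_into_into)
  have pc: "p x \<in> carrier M" if "x \<in> carrier L" for x
    using p that by (rule bij_betwE[rule_format])
  have t: "ternop M a b c \<in> carrier M"
    if "a \<in> carrier M" "b \<in> carrier M" "c \<in> carrier M" for a b c
    using M that by (simp add: ternary_system_def)
  have xi: "xi L M p l u v \<in> carrier L" if "u \<in> carrier L" "v \<in> carrier L" for u v
    unfolding xi_def using that l L by (intro ldiv_closed inv t pc left_quasigroup_closed)
  have "eta L M p l v u \<in> carrier L" if "u \<in> carrier L" "v \<in> carrier L" for u v
    unfolding eta_def using that l L by (intro ldiv_closed left_quasigroup_closed xi)
  with xi show ?thesis
    by (auto simp: R_map_def)
qed

end

theory Submission
  imports Defs
begin

text \<open>
  A pair \<open>(u, v)\<close> at the parameter \<open>\<lambda>\<close> is best read as the path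
  \<open>\<lambda>, \<lambda>u, (\<lambda>u)v\<close> in \<open>L\<close>. Since left translations of \<open>L\<close> are bijective, for fixed \<open>\<lambda>\<close> the pair
  and the path determine each other, and transporting along \<open>\<pi>\<close> the paths become arbitrary triples
  \<open>(a, b, c)\<close> of elements of \<open>M\<close>. In these coordinates the map \<open>P\<^sub>L R(\<lambda>)\<close> fixes the end points
  and replaces the middle point \<open>b\<close> by \<open>\<mu>(a, b, c)\<close> (lemma \<open>R_map_path\<close>).

  The unitary condition says that \<open>P\<^sub>L R(\<lambda>)\<close> is an involution, so it is equivalent to
  \<open>\<mu>(a, \<mu>(a, b, c), c) = b\<close> for all \<open>a, b, c\<close>
  (lemma \<open>unitary_condition_iff_ternop_involutive\<close>). For \<open>\<mu>(a, b, c) = b * (a \<setminus> c)\<close> the left-hand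
  side is \<open>(b * d) * d\<close> with \<open>d = a \<setminus> c\<close>, and \<open>d\<close> takes every value in \<open>G\<close> because \<open>c = a * d\<close> is
  a possible choice of \<open>c\<close>.
\<close>

lemma left_quasigroup_cancel:
  assumes "left_quasigroup L" "u \<in> carrier L" "v \<in> carrier L" "w \<in> carrier L"
    and "u \<cdot>\<^bsub>L\<^esub> v = u \<cdot>\<^bsub>L\<^esub> w"
  shows "v = w"
  using assms unfolding left_quasigroup_def by metis

lemma ldiv_mult:
  assumes "left_quasigroup L" "u \<in> carrier L" "v \<in> carrier L"
  shows "u \<setminus>\<^bsub>L\<^esub> (u \<cdot>\<^bsub>L\<^esub> v) = v"
  by (meson assms ldiv_closed left_quasigroup_cancel left_quasigroup_closed)

text \<open>
  In path coordinates \<open>R(\<lambda>)\<close> moves only the middle point: \<open>\<xi>\<close> is defined so that \<open>x\<close> leads to the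
  new middle point, and \<open>\<eta>\<close> so that \<open>y\<close> leads from there to the old end point. The result is
  \<open>(y, x)\<close> rather than \<open>(x, y)\<close>, which is why the flip enters the unitary condition.
\<close>

lemma R_map_path:
  assumes L: "left_quasigroup L" and M: "ternary_system M"
    and p: "bij_betw p (carrier L) (carrier M)"
    and l: "l \<in> carrier L" and u: "u \<in> carrier L" and v: "v \<in> carrier L"
  obtains x y where "R_map L M p l (u, v) = (y, x)"
    and "x \<in> carrier L" and "y \<in> carrier L"
    and "p (l \<cdot>\<^bsub>L\<^esub> x) = ternop M (p l) (p (l \<cdot>\<^bsub>L\<^esub> u)) (p ((l \<cdot>\<^bsub>L\<^esub> u) \<cdot>\<^bsub>L\<^esub> v))"
    and "(l \<cdot>\<^bsub>L\<^esub> x) \<cdot>\<^bsub>L\<^esub> y = (l \<cdot>\<^bsub>L\<^esub> u) \<cdot>\<^bsub>L\<^esub> v"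
proof -
  define m where "m = ternop M (p l) (p (l \<cdot>\<^bsub>L\<^esub> u)) (p ((l \<cdot>\<^bsub>L\<^esub> u) \<cdot>\<^bsub>L\<^esub> v))"
  define x where "x = xi L M p l u v"
  define y where "y = eta L M p l v u"
  have lu: "l \<cdot>\<^bsub>L\<^esub> u \<in> carrier L" and luv: "(l \<cdot>\<^bsub>L\<^esub> u) \<cdot>\<^bsub>L\<^esub> v \<in> carrier L"
    using L l u v by (simp_all add: left_quasigroup_closed)
  have m: "m \<in> carrier M"
    using M bij_betwE[OF p] l lu luv by (simp add: m_def ternary_system_def)
  have x_def': "x = l \<setminus>\<^bsub>L\<^esub> inv_into (carrier L) p m"
    by (simp add: x_def xi_def m_def)
  have y_def': "y = (l \<cdot>\<^bsub>L\<^esub> x) \<setminus>\<^bsub>L\<^esub> ((l \<cdot>\<^bsub>L\<^esub> u) \<cdot>\<^bsub>L\<^esub> v)"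
    by (simp add: y_def eta_def x_def)
  have im: "inv_into (carrier L) p m \<in> carrier L"
    using p m by (metis bij_betw_def inv_into_into)
  have x: "x \<in> carrier L" and lx: "l \<cdot>\<^bsub>L\<^esub> x = inv_into (carrier L) p m"
    unfolding x_def' using ldiv_closed[OF L l im] .
  have y: "y \<in> carrier L" and lxy: "(l \<cdot>\<^bsub>L\<^esub> x) \<cdot>\<^bsub>L\<^esub> y = (l \<cdot>\<^bsub>L\<^esub> u) \<cdot>\<^bsub>L\<^esub> v"
    unfolding y_def' using ldiv_closed[OF L _ luv] left_quasigroup_closed[OF L l x] by auto
  have "p (l \<cdot>\<^bsub>L\<^esub> x) = m"
    using lx bij_betw_inv_into_right[OF p m] by simp
  with x y lxy show thesis
    by (intro that[of y x]) (simp_all add: R_map_def x_def y_def m_def)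
qed

text \<open>
  Both directions compare the middle points of a path before and after two applications of
  \<open>P\<^sub>L R(\<lambda>)\<close>; the end points agree in any case.
\<close>

lemma unitary_condition_iff_ternop_involutive:
  assumes L: "left_quasigroup L" and M: "ternary_system M"
    and p: "bij_betw p (carrier L) (carrier M)"
  shows "unitary_condition L (R_map L M p) \<longleftrightarrow>
    (\<forall>a\<in>carrier M. \<forall>b\<in>carrier M. \<forall>c\<in>carrier M. ternop M a (ternop M a b c) c = b)"
    (is "?unitary \<longleftrightarrow> ?involutive")
proof
  assume unitary: ?unitary
  show ?involutive
  proof (intro ballI)
    fix a b c
    assume "a \<in> carrier M" "b \<in> carrier M" "c \<in> carrier M"
    then have "a \<in> p ` carrier L" "b \<in> p ` carrier L" "c \<in> p ` carrier L"
      using bij_betw_imp_surj_on[OF p] by simp_all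
    then obtain l m n where l: "l \<in> carrier L" "p l = a" and m: "m \<in> carrier L" "p m = b"
      and n: "n \<in> carrier L" "p n = c"
      by blast
    obtain u v where u: "u \<in> carrier L" "l \<cdot>\<^bsub>L\<^esub> u = m" and v: "v \<in> carrier L" "m \<cdot>\<^bsub>L\<^esub> v = n"
      using ldiv_closed[OF L l(1) m(1)] ldiv_closed[OF L m(1) n(1)] by blast
    obtain x y where xy: "R_map L M p l (u, v) = (y, x)" "x \<in> carrier L" "y \<in> carrier L"
      "p (l \<cdot>\<^bsub>L\<^esub> x) = ternop M a b c" "(l \<cdot>\<^bsub>L\<^esub> x) \<cdot>\<^bsub>L\<^esub> y = n"
      using R_map_path[OF L M p l(1) u(1) v(1), unfolded u(2) v(2) l(2) m(2) n(2)] .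
    obtain x' y' where xy': "R_map L M p l (x, y) = (y', x')"
      "p (l \<cdot>\<^bsub>L\<^esub> x') = ternop M a (ternop M a b c) c"
      using R_map_path[OF L M p l(1) xy(2,3), unfolded xy(4,5) l(2) n(2)] by blast
    have "(R_map L M p l \<circ> prod.swap \<circ> R_map L M p l) (u, v) = (v, u)"
      using unitary l u v by (simp add: unitary_condition_def)
    then have "x' = u"
      using xy(1) xy'(1) by simp
    then show "ternop M a (ternop M a b c) c = b"
      using xy'(2) u m by simp
  qed
next
  assume involutive: ?involutive
  have "(R_map L M p l \<circ> prod.swap \<circ> R_map L M p l) (u, v) = (v, u)"
    if l: "l \<in> carrier L" and u: "u \<in> carrier L" and v: "v \<in> carrier L" for l u v
  proof -
    have lu: "l \<cdot>\<^bsub>L\<^esub> u \<in> carrier L" and luv: "(l \<cdot>\<^bsub>L\<^esub> u) \<cdot>\<^bsub>L\<^esub> v \<in> carrier L"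
      using L l u v by (simp_all add: left_quasigroup_closed)
    obtain x y where xy: "R_map L M p l (u, v) = (y, x)" "x \<in> carrier L" "y \<in> carrier L"
      "p (l \<cdot>\<^bsub>L\<^esub> x) = ternop M (p l) (p (l \<cdot>\<^bsub>L\<^esub> u)) (p ((l \<cdot>\<^bsub>L\<^esub> u) \<cdot>\<^bsub>L\<^esub> v))"
      "(l \<cdot>\<^bsub>L\<^esub> x) \<cdot>\<^bsub>L\<^esub> y = (l \<cdot>\<^bsub>L\<^esub> u) \<cdot>\<^bsub>L\<^esub> v"
      using R_map_path[OF L M p l u v] .
    obtain x' y' where xy': "R_map L M p l (x, y) = (y', x')" "x' \<in> carrier L" "y' \<in> carrier L"
      "p (l \<cdot>\<^bsub>L\<^esub> x') = ternop M (p l) (p (l \<cdot>\<^bsub>L\<^esub> x)) (p ((l \<cdot>\<^bsub>L\<^esub> x) \<cdot>\<^bsub>L\<^esub> y))"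
      "(l \<cdot>\<^bsub>L\<^esub> x') \<cdot>\<^bsub>L\<^esub> y' = (l \<cdot>\<^bsub>L\<^esub> x) \<cdot>\<^bsub>L\<^esub> y"
      using R_map_path[OF L M p l xy(2,3)] .
    have "p (l \<cdot>\<^bsub>L\<^esub> x') = p (l \<cdot>\<^bsub>L\<^esub> u)"
      using involutive xy(4,5) xy'(4) bij_betwE[OF p] l lu luv by simp
    then have "l \<cdot>\<^bsub>L\<^esub> x' = l \<cdot>\<^bsub>L\<^esub> u"
      using p lu left_quasigroup_closed[OF L l xy'(2)] by (meson bij_betw_def inj_onD)
    then have x': "x' = u"
      using left_quasigroup_cancel[OF L l xy'(2) u] by simp
    then have "y' = v"
      using left_quasigroup_cancel[OF L lu xy'(3) v] xy(5) xy'(5) by simp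
    with x' show ?thesis
      using xy(1) xy'(1) by simp
  qed
  then show ?unitary
    by (auto simp: unitary_condition_def)
qed

theorem proposition7p5:
  fixes G :: "'g magma" (structure)
    and L :: "'l magma"
    and p :: "'l \<Rightarrow> 'g"
  assumes "left_quasigroup G"
    and "\<forall>a\<in>carrier G. \<forall>b\<in>carrier G. \<forall>c\<in>carrier G. \<forall>d\<in>carrier G.
      (b \<cdot> c) \<cdot> (a \<setminus> ((a \<cdot> c) \<cdot> ((b \<cdot> c) \<setminus> (b \<cdot> d)))) = b \<cdot> (a \<setminus> ((a \<cdot> c) \<cdot> d))"
    and "\<forall>a\<in>carrier G. \<forall>b\<in>carrier G. \<forall>c\<in>carrier G. \<forall>d\<in>carrier G.
      (a \<cdot> c) \<cdot> ((b \<cdot> c) \<setminus> (b \<cdot> d)) =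
      ((a \<cdot> c) \<cdot> d) \<cdot> ((b \<cdot> (a \<setminus> ((a \<cdot> c) \<cdot> d))) \<setminus> (b \<cdot> d))"
    and "left_quasigroup L"
    and "bij_betw p (carrier L) (carrier G)"
  shows "unitary_condition L (R_map L (mu3_system G) p) \<longleftrightarrow>
    (\<forall>a\<in>carrier G. \<forall>b\<in>carrier G. (a \<cdot> b) \<cdot> b = a)"
proof -
  have "unitary_condition L (R_map L (mu3_system G) p) \<longleftrightarrow>
    (\<forall>a\<in>carrier G. \<forall>b\<in>carrier G. \<forall>c\<in>carrier G. (b \<cdot> (a \<setminus> c)) \<cdot> (a \<setminus> c) = b)"
    using unitary_condition_iff_ternop_involutive
      [OF assms(4) ternary_system_mu3_system[OF assms(1)], of p] assms(5)
    by (simp add: mu3_system_def)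
  also have "\<dots> \<longleftrightarrow> (\<forall>a\<in>carrier G. \<forall>b\<in>carrier G. (a \<cdot> b) \<cdot> b = a)"
  proof
    assume involutive: "\<forall>a\<in>carrier G. \<forall>b\<in>carrier G. \<forall>c\<in>carrier G. (b \<cdot> (a \<setminus> c)) \<cdot> (a \<setminus> c) = b"
    show "\<forall>a\<in>carrier G. \<forall>b\<in>carrier G. (a \<cdot> b) \<cdot> b = a"
    proof (intro ballI)
      fix a b assume a: "a \<in> carrier G" and b: "b \<in> carrier G"
      \<comment> \<open>Any base point realises \<open>b\<close> as a left quotient; \<open>a\<close> itself will do.\<close>
      have "a \<setminus> (a \<cdot> b) = b"
        using assms(1) a b by (rule ldiv_mult)
      then show "(a \<cdot> b) \<cdot> b = a"
        using involutive a left_quasigroup_closed[OF assms(1) a b] by metis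
    qed
  qed (use ldiv_closed(1)[OF assms(1)] in blast)
  finally show ?thesis .
qed

end
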